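(* Let $k \geq 2$ be an integer. Then there exist a polynomial $f(X) \in \mathbb{Q}[X]$ of degree $k-1$ and an integer $N_0$ (depending on $f$) such that \[ f(n) < \frac{1}{\sum_{i=n+1}^{\infty} i^{-k}} < f(n)+1 \] holds for all integers $n \geq N_0$. Moreover, $f$ is unique up to the constant term: any two polynomials in $\mathbb{Q}[X]$ of degree $k-1$ having this property (each with its own integer $N_0$) differ by a constant. *)

theory Defs
  imports "HOL-Analysis.Analysis" "HOL-Computational_Algebra.Polynomial"
begin

(* The sum of i^(-k) over i >= n + 1, reindexed to start at 0.  It converges for k >= 2. *)
definition zeta_tail :: "nat \<Rightarrow> nat \<Rightarrow> real" where
  "zeta_tail k n = (\<Sum>i. 1 / real (n + 1 + i) ^ k)"

(* The threshold N0 and n are natural numbers: for n < 0 the sum would contain the undefined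
   term at i = 0. *)
definition brackets_reciprocal_tail :: "nat \<Rightarrow> rat poly \<Rightarrow> bool" where
  "brackets_reciprocal_tail k f \<longleftrightarrow>
     (\<exists>N0. \<forall>n\<ge>N0.
        of_rat (poly f (of_nat n)) < 1 / zeta_tail k n \<and>
        1 / zeta_tail k n < of_rat (poly f (of_nat n)) + 1)"

end

theory Submission
  imports Defs
begin

text \<open>Write \<open>d = k - 1\<close>. There is a polynomial \<open>F\<close> of degree \<open>d\<close> with leading
  coefficient \<open>d\<close> such that the numerator of \<open>1 / F (x - 1) - 1 / F x - 1 / x ^ k\<close> has degree
  below \<open>d\<close>. Adding a constant \<open>c\<close> to \<open>F\<close> makes the leading term of this numerator
  \<open>- 2 * d * c * x ^ d\<close>, so \<open>c = - 1 / 2\<close> and \<open>c = 1 / 2\<close> give opposite signs for large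
  \<open>x\<close>; telescoping then bounds the tail from both sides, and \<open>F - 1 / 2\<close> is the
  required polynomial. Two such polynomials differ by less than 1 at all large integers, hence
  by a constant.\<close>

section \<open>Signs of polynomials at large arguments\<close>

lemma poly_eventually_pos:
  fixes p :: "'a::linordered_field poly"
  assumes "lead_coeff p > 0"
  shows "\<exists>N. \<forall>x\<ge>N. poly p x > 0"
proof -
  \<comment> \<open>Mere positivity would not survive the induction: \<open>x * poly p x\<close>
    must outgrow the new constant term \<open>a\<close>, which needs a fixed positive lower bound
    for \<open>poly p x\<close>.\<close>
  have "\<exists>N. \<forall>x\<ge>N. poly p x \<ge> lead_coeff p"
    using assms
  proof (induction p)
    case 0
    then show ?case by simp
  next
    case (pCons a p)
    show ?case
    proof (cases "p = 0")
      case True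
      then show ?thesis by auto
    next
      case False
      let ?l = "lead_coeff p"
      have l: "?l > 0"
        using pCons.prems False by simp
      then obtain N where N: "\<And>x. x \<ge> N \<Longrightarrow> poly p x \<ge> ?l"
        using pCons.IH by blast
      \<comment> \<open>The threshold makes \<open>x * ?l\<close> at least
        \<open>?l + \<bar>a\<bar>\<close>, so \<open>a\<close> is absorbed and \<open>?l\<close>
        remains.\<close>
      have "poly (pCons a p) x \<ge> ?l" if x: "x \<ge> max N (1 + \<bar>a\<bar> / ?l)" for x
      proof -
        have "(1 + \<bar>a\<bar> / ?l) * ?l \<le> x * poly p x"
          using x l N[of x] by (intro mult_mono) (auto intro: order_trans[of 0 "1 + \<bar>a\<bar> / ?l"])
        moreover have "(1 + \<bar>a\<bar> / ?l) * ?l = ?l + \<bar>a\<bar>"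
          using False by (simp add: field_simps)
        ultimately show ?thesis
          using abs_ge_minus_self[of a] by (simp add: algebra_simps)
      qed
      then show ?thesis
        using False by (intro exI[of _ "max N (1 + \<bar>a\<bar> / ?l)"]) simp
    qed
  qed
  then show ?thesis
    using assms by (meson less_le_trans)
qed

lemma poly_of_nat_eventually_pos:
  fixes p :: "rat poly"
  assumes "lead_coeff p > 0"
  shows "eventually (\<lambda>n. poly p (of_nat n) > 0) sequentially"
proof -
  obtain N where N: "\<And>x. x \<ge> N \<Longrightarrow> poly p x > 0"
    using poly_eventually_pos[OF assms] by blast
  obtain M :: nat where M: "N \<le> of_nat M"
    using real_arch_simple by blast
  show ?thesis
    unfolding eventually_sequentially
    using N M by (meson of_nat_le_iff order_trans)
qed

lemma poly_of_nat_eventually_gt: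
  fixes p :: "rat poly"
  assumes "lead_coeff p > 0" "degree p > 0"
  shows "eventually (\<lambda>n. poly p (of_nat n) > c) sequentially"
proof -
  have "degree [:- c:] < degree p"
    using assms(2) by simp
  then have "lead_coeff (p + [:- c:]) = lead_coeff p"
    by (metis add.commute lead_coeff_add_le)
  then show ?thesis
    using poly_of_nat_eventually_pos[of "p + [:- c:]"] assms(1) by simp
qed

section \<open>The backward shift and the coefficients of the defect\<close>

definition backshift :: "'a::comm_ring_1 poly \<Rightarrow> 'a poly" where
  "backshift p = pcompose p [:-1, 1:]"

text \<open>The numerator of \<open>1 / F (x - 1) - 1 / F x - 1 / x ^ (d + 1)\<close>.\<close>
definition telescope_defect :: "nat \<Rightarrow> 'a::comm_ring_1 poly \<Rightarrow> 'a poly" where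
  "telescope_defect d F = monom 1 (Suc d) * (F - backshift F) - F * backshift F"

lemma poly_backshift: "poly (backshift p) x = poly p (x - 1)"
  by (simp add: backshift_def poly_pcompose)

lemma degree_backshift: "degree (backshift p) = degree p"
  for p :: "'a::idom poly"
  by (simp add: backshift_def degree_pcompose)

lemma lead_coeff_backshift: "coeff (backshift p) (degree p) = lead_coeff p"
  for p :: "'a::idom poly"
  using lead_coeff_comp[of "[:-1, 1:]" p] by (simp add: backshift_def degree_pcompose)

lemma backshift_add: "backshift (p + q) = backshift p + backshift q"
  by (simp add: backshift_def pcompose_add)

lemma backshift_monom: "backshift (monom c j) = smult c ([:-1, 1:] ^ j)"
proof (induction j)
  case 0
  then show ?case by (simp add: backshift_def monom_0)
next
  case (Suc j)
  then show ?case by (simp add: backshift_def monom_Suc pcompose_pCons)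
qed

text \<open>By the binomial theorem \<open>x^j - (x-1)^j\<close> starts with
  \<open>j * x^(j-1)\<close>, and the factor \<open>x^(d+1)\<close> moves this term to degree
  \<open>d + j\<close>.\<close>

lemma coeff_monom_diff_backshift:
  "coeff (monom 1 (Suc d) * (monom c j - backshift (monom c j))) (d + j) = of_nat j * c"
  for c :: "'a::idom"
proof (cases j)
  case 0
  then show ?thesis by (simp add: coeff_monom_mult)
next
  case (Suc i)
  then have "d + j - Suc d = i" by simp
  moreover have "(Suc i choose i) = Suc i"
    by (metis binomial_Suc_n)
  ultimately show ?thesis
    using Suc by (simp add: coeff_monom_mult backshift_monom coeff_linear_poly_power algebra_simps del: power_Suc)
qed

lemma coeff_monom_diff_backshift_eq_0:
  "i > d + j \<Longrightarrow> coeff (monom 1 (Suc d) * (monom c j - backshift (monom c j))) i = 0"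
  for c :: "'a::idom"
proof -
  assume i: "i > d + j"
  have "coeff (monom c j - backshift (monom c j)) m = 0" if "m \<ge> j" for m
  proof (cases "m = j")
    case True
    then show ?thesis by (simp add: backshift_monom coeff_linear_power)
  next
    case False
    with that have "degree (backshift (monom c j)) < m"
      using degree_monom_le[of c j] by (simp add: degree_backshift)
    then show ?thesis using False by (simp add: coeff_eq_0)
  qed
  then show ?thesis using i by (simp add: coeff_monom_mult del: coeff_diff)
qed

text \<open>The difference term contributes \<open>j * c\<close>. Each of the two cross products
  takes away \<open>lead_coeff F * c\<close>, since the shift keeps leading coefficients. The term
  quadratic in \<open>c\<close> has degree at most \<open>2 * j\<close>, which is below
  \<open>d + j\<close>, so the dependence on \<open>c\<close> is linear here.\<close>

lemma coeff_telescope_defect_add_monom: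
  fixes F :: "'a::idom poly"
  assumes F: "degree F = d" and "j < d" "i \<ge> d + j"
  shows "coeff (telescope_defect d (F + monom c j)) i =
    coeff (telescope_defect d F) i - (if i = d + j then (2 * lead_coeff F - of_nat j) * c else 0)"
proof -
  let ?m = "monom c j"
  let ?S = "backshift ?m"
  let ?G = "backshift F"
  have split: "telescope_defect d (F + ?m) = telescope_defect d F
     + monom 1 (Suc d) * (?m - ?S) - ?m * ?G - F * ?S - ?m * ?S"
    by (simp add: telescope_defect_def backshift_add algebra_simps)
  have dm: "degree ?m \<le> j" by (rule degree_monom_le)
  have dS: "degree ?S \<le> j" using dm by (simp add: degree_backshift)
  have dG: "degree ?G = d" using F by (simp add: degree_backshift)
  have 1: "coeff (?m * ?S) i = 0"
    using degree_mult_le[of ?m ?S] dm dS assms by (intro coeff_eq_0) linarith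
  show ?thesis
  proof (cases "i = d + j")
    case True
    have 2: "coeff (?m * ?G) i = lead_coeff F * c"
      using True F lead_coeff_backshift[of F] by (simp add: coeff_monom_mult)
    have 3: "coeff (F * ?S) i = lead_coeff F * c"
    \<comment> \<open>The top coefficient of a product is read off at the sum of the exact degrees,
      and \<open>?m\<close> has degree \<open>j\<close> only for nonzero \<open>c\<close>.\<close>
    proof (cases "c = 0")
      case True
      then show ?thesis by (simp add: backshift_def)
    next
      case False
      then have "degree ?m = j" by (simp add: degree_monom_eq)
      then show ?thesis
        using True F coeff_mult_degree_sum[of F ?S] lead_coeff_backshift[of ?m]
        by (simp add: degree_backshift)
    qed
    show ?thesis
      unfolding split
      using True 1 2 3 coeff_monom_diff_backshift[of d c j] by (simp add: algebra_simps)
  next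
    case False
    then have i: "i > d + j" using assms by simp
    have 2: "coeff (?m * ?G) i = 0"
      using degree_mult_le[of ?m ?G] dm dG i by (intro coeff_eq_0) linarith
    have 3: "coeff (F * ?S) i = 0"
      using degree_mult_le[of F ?S] F dS i by (intro coeff_eq_0) linarith
    show ?thesis
      unfolding split
      using False 1 2 3 coeff_monom_diff_backshift_eq_0[OF i, of c] by simp
  qed
qed

text \<open>For \<open>monom a d\<close> the coefficient in degree \<open>2 * d\<close> is
  \<open>d * a - a * a\<close>; this is why the leading coefficient is taken to be
  \<open>d\<close>.\<close>

lemma coeff_telescope_defect_monom:
  assumes "i \<ge> 2 * d"
  shows "coeff (telescope_defect d (monom (of_nat d :: 'a::idom) d)) i = 0"
proof -
  let ?m = "monom (of_nat d :: 'a) d"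
  let ?S = "backshift ?m"
  show ?thesis
  proof (cases "i = 2 * d")
    case True
    have "coeff (?m * ?S) i = of_nat d * of_nat d"
      using True by (simp add: coeff_monom_mult backshift_monom coeff_linear_power)
    moreover have "coeff (monom 1 (Suc d) * (?m - ?S)) i = of_nat d * of_nat d"
      using True coeff_monom_diff_backshift[of d "of_nat d :: 'a" d] by (simp add: mult_2)
    ultimately show ?thesis
      by (simp add: telescope_defect_def)
  next
    case False
    have "coeff (?m * ?S) i = 0"
      using degree_mult_le[of ?m ?S] degree_monom_le[of "of_nat d :: 'a" d] False assms
      by (intro coeff_eq_0) (simp add: degree_backshift)
    then show ?thesis
      using coeff_monom_diff_backshift_eq_0[of d d i "of_nat d :: 'a"] False assms
      by (simp add: telescope_defect_def)
  qed
qed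

lemma degree_lead_coeff_add_monom:
  assumes "degree F = d" "j < d"
  shows "degree (F + monom c j) = d" "lead_coeff (F + monom c j) = lead_coeff F"
proof -
  have "degree (monom c j) < degree F"
    using degree_monom_le[of c j] assms by linarith
  then show "degree (F + monom c j) = d" "lead_coeff (F + monom c j) = lead_coeff F"
    using assms by (simp_all add: degree_add_eq_left coeff_eq_0)
qed

text \<open>The factor \<open>2 * d - j\<close> by which the coefficient of \<open>x ^ j\<close> enters the defect in
  degree \<open>d + j\<close> never vanishes, so the coefficients of \<open>F\<close> can be chosen one after the
  other from the top.\<close>
lemma exists_small_telescope_defect:
  assumes "j \<le> d"
  shows "\<exists>F :: 'a::field_char_0 poly. degree F = d \<and> lead_coeff F = of_nat d \<and>
    (\<forall>i \<ge> d + j. coeff (telescope_defect d F) i = 0)"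
  using assms
proof (induction j rule: inc_induct)
  case base
  have "degree (monom (of_nat d :: 'a) d) = d"
    by (cases "d = 0") (simp_all add: degree_monom_eq)
  then show ?case
    using coeff_telescope_defect_monom[of d, where ?'a = 'a]
    by (intro exI[of _ "monom (of_nat d) d"]) (simp add: mult_2)
next
  case (step j)
  then obtain F :: "'a poly" where F: "degree F = d" "lead_coeff F = of_nat d"
    "\<And>i. i \<ge> d + Suc j \<Longrightarrow> coeff (telescope_defect d F) i = 0"
    by blast
  define c where "c = coeff (telescope_defect d F) (d + j) / (2 * of_nat d - of_nat j)"
  have "(2 * of_nat d - of_nat j :: 'a) = of_nat (2 * d - j)"
    using step.hyps by (simp add: of_nat_diff)
  also have "\<dots> \<noteq> 0"
    using step.hyps by (simp only: of_nat_eq_0_iff)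
  finally have c: "(2 * of_nat d - of_nat j) * c = coeff (telescope_defect d F) (d + j)"
    by (simp add: c_def)
  have "coeff (telescope_defect d (F + monom c j)) i = 0" if "i \<ge> d + j" for i
    using that c F step.hyps coeff_telescope_defect_add_monom[of F d j i c] by auto
  then show ?case
    using F degree_lead_coeff_add_monom[of F d j c] step.hyps
    by (intro exI[of _ "F + monom c j"]) simp
qed

lemma poly_telescope_defect:
  fixes F :: "'a::field poly"
  assumes "x \<noteq> 0" "poly F x \<noteq> 0" "poly F (x - 1) \<noteq> 0"
  shows "1 / poly F (x - 1) - 1 / poly F x - 1 / x ^ Suc d =
    poly (telescope_defect d F) x / (poly F (x - 1) * poly F x * x ^ Suc d)"
  using assms
  by (simp add: telescope_defect_def poly_backshift poly_monom divide_simps algebra_simps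
      del: power_Suc)

section \<open>The tail series and telescoping sums of reciprocals\<close>

lemma summable_zeta_tail:
  assumes "k \<ge> 2"
  shows "summable (\<lambda>i. 1 / real (n + 1 + i) ^ k)"
proof -
  have "summable (\<lambda>i. inverse (real i ^ k))"
    using inverse_power_summable[OF assms, where ?'a = real] by simp
  then have "summable (\<lambda>i. inverse (real (i + (n + 1)) ^ k))"
    by (rule summable_ignore_initial_segment)
  then show ?thesis
    by (simp add: field_simps)
qed

lemma suminf_strict_mono:
  fixes a b :: "nat \<Rightarrow> real"
  assumes "summable a" "summable b" "\<And>i. a i < b i"
  shows "suminf a < suminf b"
  using suminf_pos[OF summable_diff[OF assms(2,1)]] suminf_diff[OF assms(2,1)] assms(3) by simp

lemma zeta_tail_pos:
  assumes "k \<ge> 2"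
  shows "zeta_tail k n > 0"
  unfolding zeta_tail_def by (intro suminf_pos summable_zeta_tail assms) simp

lemma telescoping_reciprocals:
  fixes u :: "nat \<Rightarrow> real"
  assumes "filterlim u at_top sequentially"
  shows "(\<lambda>i. 1 / u (n + i) - 1 / u (Suc (n + i))) sums (1 / u n)"
proof -
  have "(\<lambda>i. 1 / u i) \<longlonglongrightarrow> 0"
    using tendsto_inverse_0_at_top[OF assms] by (simp add: inverse_eq_divide)
  then have "(\<lambda>i. 1 / u (n + i)) \<longlonglongrightarrow> 0"
    using LIMSEQ_ignore_initial_segment[of _ 0 n] by (simp add: add.commute)
  from telescope_sums'[OF this] show ?thesis by simp
qed

lemma filterlim_of_rat_poly:
  fixes f :: "rat poly"
  assumes "lead_coeff f > 0" "degree f > 0"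
  shows "filterlim (\<lambda>n. of_rat (poly f (of_nat n)) :: real) at_top sequentially"
  unfolding filterlim_at_top
proof
  fix Z :: real
  obtain m :: nat where m: "Z \<le> of_nat m" using real_arch_simple by blast
  from poly_of_nat_eventually_gt[OF assms, of "of_nat m"]
  show "eventually (\<lambda>n. Z \<le> of_rat (poly f (of_nat n))) sequentially"
  proof eventually_elim
    case (elim n)
    then have "(of_rat (of_nat m) :: real) < of_rat (poly f (of_nat n))"
      by (simp only: of_rat_less)
    then show ?case using m by simp
  qed
qed

text \<open>The defect has leading coefficient \<open>s\<close>, so its sign is eventually that of
  \<open>s\<close>. Multiplying by \<open>s\<close> lets one statement serve both signs, hence both
  the upper and the lower bound of the tail.\<close>

lemma eventually_reciprocal_diff:
  fixes f :: "rat poly"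
  assumes "degree f = d" "d > 0" "lead_coeff f > 0" and s: "s \<noteq> 0"
    and top: "coeff (telescope_defect d f) d = s"
    and above: "\<And>i. i > d \<Longrightarrow> coeff (telescope_defect d f) i = 0"
  shows "eventually (\<lambda>n. of_rat (poly f (of_nat n)) > (0::real) \<and>
    0 < of_rat s * (1 / of_rat (poly f (of_nat n)) - 1 / of_rat (poly f (of_nat (Suc n)))
         - 1 / real (Suc n) ^ Suc d)) sequentially"
proof -
  let ?P = "telescope_defect d f"
  have deg: "degree ?P = d"
    using le_degree[of ?P d] degree_le[of d ?P] top s above by auto
  have "lead_coeff (smult s ?P) > 0"
    using top s deg by (auto simp: zero_less_mult_iff)
  then have ev: "eventually (\<lambda>n. poly (smult s ?P) (of_nat n) > 0) sequentially"
    by (rule poly_of_nat_eventually_pos)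
  have evf: "eventually (\<lambda>n. poly f (of_nat n) > 0) sequentially"
    by (rule poly_of_nat_eventually_pos) fact
  \<comment> \<open>The defect is evaluated at \<open>x = n + 1\<close>, so that the reciprocals
    involved are those at \<open>n\<close> and \<open>n + 1\<close>.\<close>
  have "eventually (\<lambda>n. poly (smult s ?P) (of_nat (Suc n)) > 0 \<and>
      poly f (of_nat n) > 0 \<and> poly f (of_nat (Suc n)) > 0) sequentially"
    using ev evf
      eventually_sequentially_Suc[of "\<lambda>n. poly (smult s ?P) (of_nat n) > 0"]
      eventually_sequentially_Suc[of "\<lambda>n. poly f (of_nat n) > 0"]
    by (intro eventually_conj) (simp_all del: of_nat_Suc)
  then show ?thesis
  proof eventually_elim
    case (elim n)
    let ?x = "of_nat (Suc n) :: rat"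
    let ?D = "1 / poly f (of_nat n) - 1 / poly f ?x - 1 / ?x ^ Suc d"
    have x: "?x > 0" "?x - 1 = of_nat n" by simp_all
    have "?D = poly ?P ?x / (poly f (of_nat n) * poly f ?x * ?x ^ Suc d)"
      using poly_telescope_defect[of ?x f d] elim x by (simp del: power_Suc of_nat_Suc)
    then have "s * ?D = poly (smult s ?P) ?x / (poly f (of_nat n) * poly f ?x * ?x ^ Suc d)"
      by simp
    also have "\<dots> > 0"
      using elim x by (intro divide_pos_pos mult_pos_pos zero_less_power) auto
    finally have "(0::real) < of_rat (s * ?D)"
      by (simp only: zero_less_of_rat_iff)
    moreover have "(of_rat (s * ?D) :: real) =
      of_rat s * (1 / of_rat (poly f (of_nat n)) - 1 / of_rat (poly f ?x) - 1 / real (Suc n) ^ Suc d)"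
      by (simp add: of_rat_mult of_rat_diff of_rat_divide of_rat_power del: power_Suc of_nat_Suc)
    ultimately show ?case
      using elim by (simp del: power_Suc of_nat_Suc)
  qed
qed

section \<open>Existence of a bracketing polynomial\<close>

lemma bracket_exists:
  assumes "d \<ge> 1"
  shows "\<exists>f :: rat poly. degree f = d \<and> brackets_reciprocal_tail (Suc d) f"
proof -
  obtain F :: "rat poly" where F: "degree F = d" "lead_coeff F = of_nat d"
    "\<And>i. i \<ge> d \<Longrightarrow> coeff (telescope_defect d F) i = 0"
    using exists_small_telescope_defect[of 0 d, where ?'a = rat] by auto
  define f where "f c = F + monom c 0" for c
  have f: "degree (f c) = d" "lead_coeff (f c) = of_nat d" for c
    using F degree_lead_coeff_add_monom[of F d 0 c] assms by (simp_all add: f_def)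
  have coeff_f: "coeff (telescope_defect d (f c)) i = (if i = d then - 2 * of_nat d * c else 0)"
    if "i \<ge> d" for c i
    using coeff_telescope_defect_add_monom[of F d 0 i c] F assms that by (simp add: f_def)
  define u where "u c n = (of_rat (poly (f c) (of_nat n)) :: real)" for c n
  have ev: "eventually (\<lambda>n. u c n > 0 \<and> 0 < of_rat (- 2 * of_nat d * c) *
      (1 / u c n - 1 / u c (Suc n) - 1 / real (Suc n) ^ Suc d)) sequentially" if "c \<noteq> 0" for c
    unfolding u_def
    by (rule eventually_reciprocal_diff) (use f coeff_f assms that in auto)
  have sgn: "(of_rat (- 2 * of_nat d * (-1/2)) :: real) = real d"
    "(of_rat (- 2 * of_nat d * (1/2)) :: real) = - real d"
    by (simp_all add: of_rat_mult of_rat_divide of_rat_minus)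
  have sums: "(\<lambda>i. 1 / u c (n + i) - 1 / u c (Suc (n + i))) sums (1 / u c n)" for c n
    unfolding u_def by (intro telescoping_reciprocals filterlim_of_rat_poly) (use f assms in auto)
  \<comment> \<open>For \<open>c = -1/2\<close> the factor is \<open>s = d > 0\<close>: each summand
    of the tail lies below the telescoping difference. The value \<open>c = 1/2\<close> gives
    \<open>s = -d\<close> and the reverse inequality.\<close>
  obtain N1 where N1: "\<And>n. n \<ge> N1 \<Longrightarrow> u (-1/2) n > 0"
    "\<And>n. n \<ge> N1 \<Longrightarrow> 1 / real (Suc n) ^ Suc d < 1 / u (-1/2) n - 1 / u (-1/2) (Suc n)"
    using ev[of "-1/2"] assms unfolding sgn eventually_sequentially
    by (auto simp: zero_less_mult_iff simp del: power_Suc of_nat_Suc)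
  obtain N2 where N2: "\<And>n. n \<ge> N2 \<Longrightarrow> u (1/2) n > 0"
    "\<And>n. n \<ge> N2 \<Longrightarrow> 1 / u (1/2) n - 1 / u (1/2) (Suc n) < 1 / real (Suc n) ^ Suc d"
    using ev[of "1/2"] assms unfolding sgn eventually_sequentially
    by (auto simp: zero_less_mult_iff mult_less_0_iff simp del: power_Suc of_nat_Suc)
  have summ: "summable (\<lambda>i. 1 / real (Suc (n + i)) ^ Suc d)" for n
    using summable_zeta_tail[of "Suc d" n] assms by simp
  have tail: "zeta_tail (Suc d) n = (\<Sum>i. 1 / real (Suc (n + i)) ^ Suc d)" for n
    by (simp add: zeta_tail_def)
  have upper: "zeta_tail (Suc d) n < 1 / u (-1/2) n" if "n \<ge> N1" for n
    unfolding tail sums_unique[OF sums[of "-1/2" n]]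
    by (rule suminf_strict_mono[OF summ sums_summable[OF sums]]) (use N1(2) that in \<open>simp del: power_Suc of_nat_Suc\<close>)
  have lower: "1 / u (1/2) n < zeta_tail (Suc d) n" if "n \<ge> N2" for n
    unfolding tail sums_unique[OF sums[of "1/2" n]]
    by (rule suminf_strict_mono[OF sums_summable[OF sums] summ]) (use N2(2) that in \<open>simp del: power_Suc of_nat_Suc\<close>)
  \<comment> \<open>The two constants differ by exactly 1, so after taking reciprocals the upper
    bound for \<open>1 / zeta_tail\<close> is the lower one plus 1.\<close>
  have shift: "u (1/2) n = u (-1/2) n + 1" for n
    by (simp add: u_def f_def poly_monom of_rat_add of_rat_diff of_rat_divide)
  have "u (-1/2) n < 1 / zeta_tail (Suc d) n \<and> 1 / zeta_tail (Suc d) n < u (-1/2) n + 1"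
    if "n \<ge> max N1 N2" for n
    using upper[of n] lower[of n] N1(1)[of n] N2(1)[of n] zeta_tail_pos[of "Suc d" n] that assms
    unfolding shift[symmetric] by (simp add: field_simps)
  then show ?thesis
    using f(1)[of "-1/2"] unfolding brackets_reciprocal_tail_def u_def by blast
qed

section \<open>Uniqueness up to the constant term\<close>

lemma bracket_unique:
  fixes f g :: "rat poly"
  assumes "brackets_reciprocal_tail k f" "brackets_reciprocal_tail k g"
  shows "degree (f - g) = 0"
proof -
  \<comment> \<open>Chaining the lower inequality for \<open>p\<close> with the upper one for
    \<open>q\<close> through \<open>1 / zeta_tail k n\<close> leaves a comparison of
    rationals.\<close>
  have bound: "eventually (\<lambda>n. poly (p - q) (of_nat n) < 1) sequentially"
    if "brackets_reciprocal_tail k p" "brackets_reciprocal_tail k q" for p q :: "rat poly"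
  proof -
    have "eventually (\<lambda>n. of_rat (poly p (of_nat n)) < 1 / zeta_tail k n) sequentially"
      "eventually (\<lambda>n. 1 / zeta_tail k n < of_rat (poly q (of_nat n)) + 1) sequentially"
      using that unfolding brackets_reciprocal_tail_def eventually_sequentially by blast+
    then show ?thesis
    proof eventually_elim
      case (elim n)
      then have "(of_rat (poly p (of_nat n)) :: real) < of_rat (poly q (of_nat n) + 1)"
        by (simp add: of_rat_add)
      then show ?case by (simp only: of_rat_less) simp
    qed
  qed
  have neg: "\<not> (degree (p - q) > 0 \<and> lead_coeff (p - q) > 0)"
    if "brackets_reciprocal_tail k p" "brackets_reciprocal_tail k q" for p q :: "rat poly"
  proof
    assume "degree (p - q) > 0 \<and> lead_coeff (p - q) > 0"
    then have "eventually (\<lambda>n. poly (p - q) (of_nat n) > 1) sequentially"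
      by (intro poly_of_nat_eventually_gt) auto
    with bound[OF that] have "eventually (\<lambda>n::nat. False) sequentially"
      by eventually_elim simp
    then show False by simp
  qed
  \<comment> \<open>A nonconstant difference has positive leading coefficient in one of the two
    orders, and \<open>neg\<close> excludes both.\<close>
  have sym: "degree (g - f) = degree (f - g)" "lead_coeff (g - f) = - lead_coeff (f - g)"
    using degree_minus[of "f - g"] lead_coeff_minus[of "f - g"] by simp_all
  show ?thesis
  proof (rule ccontr)
    assume "degree (f - g) \<noteq> 0"
    moreover from this have "lead_coeff (f - g) \<noteq> 0"
      unfolding leading_coeff_0_iff by (metis degree_0)
    ultimately show False
      using neg[OF assms] neg[OF assms(2,1)] sym by linarith
  qed
qed

theorem theorem1p1:
  fixes k :: nat
  assumes "k \<ge> 2"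
  shows "(\<exists>f :: rat poly. degree f = k - 1 \<and> brackets_reciprocal_tail k f) \<and>
    (\<forall>f g :: rat poly.
       degree f = k - 1 \<longrightarrow> brackets_reciprocal_tail k f \<longrightarrow>
       degree g = k - 1 \<longrightarrow> brackets_reciprocal_tail k g \<longrightarrow>
       (\<exists>c :: rat. f - g = [:c:]))"
proof
  show "\<exists>f :: rat poly. degree f = k - 1 \<and> brackets_reciprocal_tail k f"
    using bracket_exists[of "k - 1"] assms by simp
  show "\<forall>f g :: rat poly.
       degree f = k - 1 \<longrightarrow> brackets_reciprocal_tail k f \<longrightarrow>
       degree g = k - 1 \<longrightarrow> brackets_reciprocal_tail k g \<longrightarrow>
       (\<exists>c :: rat. f - g = [:c:])"
    using bracket_unique by (metis degree_eq_zeroE)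
qed

end
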